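(* Let $G_0$ be a saturated elementary graph, and let $\mathcal{T}:=\{G_S\}_{S\in\mathcal{P}(G_0)}$ be a family of saturated graphs. Let $G$ be the graph obtained from the foundation $G_0$ and the family of towers $\mathcal{T}$ by the cathedral construction. Then $G$ is saturated, $G_0$ forms a factor-connected component of $G$, that is, $G[V(G_0)]\in\mathcal{G}(G)$, and it is the minimum element of the poset $(\mathcal{G}(G),\triangleleft)$.
   Context: Graphs are finite. A graph is factorizable if it has a perfect matching. A factorizable graph $G$ is saturated if $G+xy$ has more perfect matchings than $G$ for every complement edge $xy$, i.e. for every pair of distinct vertices $x,y\in V(G)$ not joined by an edge of $G$. Empty graphs are treated as factorizable and saturated. An edge of a factorizable graph $G$ is allowed if some perfect matching of $G$ contains it. A connected component of the subgraph of $G$ determined by all allowed edges is an elementary component of $G$; for each elementary component $H$, the induced subgraph $G[V(H)]$ is called a factor-connected component of $G$. $\mathcal{G}(G)$ denotes the set of all factor-connected components of $G$; their vertex sets partition $V(G)$. A factorizable graph with exactly one elementary component is called elementary. A set $X\subseteq V(G)$ is separating if every $H\in\mathcal{G}(G)$ satisfies $V(H)\subseteq X$ or $V(H)\cap X=\emptyset$. A graph is factor-critical if deleting any one vertex leaves a factorizable graph (a one-vertex graph is regarded as factor-critical). $G[X]/Y$ denotes the graph obtained from $G[X]$ by contracting $Y$ to a single vertex. For $G_1,G_2\in\mathcal{G}(G)$, write $G_1\triangleleft G_2$ if there is a separating set $X\subseteq V(G)$ with $V(G_1)\cup V(G_2)\subseteq X$ such that $G[X]/V(G_1)$ is factor-critical.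 It is known that $\triangleleft$ is a partial order on $\mathcal{G}(G)$. For $u,v\in V(G)$, write $u\sim_G v$ if $u,v$ lie in the same factor-connected component of $G$ and either $u=v$ or $G-u-v$ is not factorizable. It is known that $\sim_G$ is an equivalence relation; $\mathcal{P}(G):=V(G)/\!\sim_G$ is the generalized canonical partition. Cathedral construction: given a saturated elementary graph $G_0$ (the foundation) and a family $\{G_S\}_{S\in\mathcal{P}(G_0)}$ of saturated graphs, some possibly empty (the towers), all pairwise vertex-disjoint, join, for each $S\in\mathcal{P}(G_0)$, every vertex of $S$ to every vertex of $G_S$ by an edge. *)

theory Defs
  imports "HOL-Library.Disjoint_Sets"
begin

text \<open>Finite simple undirected graphs, with edges as two-element sets of vertices.\<close>

record 'a graph =
  verts :: "'a set"
  edges :: "'a set set"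

definition simple_graph :: "'a graph \<Rightarrow> bool" where
  "simple_graph G \<longleftrightarrow> finite (verts G) \<and> (\<forall>e\<in>edges G. e \<subseteq> verts G \<and> card e = 2)"

definition induced :: "'a graph \<Rightarrow> 'a set \<Rightarrow> 'a graph" where
  "induced G X = \<lparr>verts = verts G \<inter> X, edges = {e \<in> edges G. e \<subseteq> X}\<rparr>"

definition delete_verts :: "'a graph \<Rightarrow> 'a set \<Rightarrow> 'a graph" where
  "delete_verts G X = induced G (verts G - X)"

definition add_edge :: "'a graph \<Rightarrow> 'a \<Rightarrow> 'a \<Rightarrow> 'a graph" where
  "add_edge G x y = \<lparr>verts = verts G, edges = insert {x, y} (edges G)\<rparr>"

text \<open>The vertex \<open>None\<close> of the contracted graph is the one that (nonempty) \<open>Y\<close> is contracted to.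
  Loops are dropped and parallel edges are identified; neither affects the existence
  of perfect matchings.\<close>

definition contract :: "'a graph \<Rightarrow> 'a set \<Rightarrow> 'a option graph" where
  "contract G Y =
    (let c = (\<lambda>v. if v \<in> Y then None else Some v)
     in \<lparr>verts = c ` verts G, edges = {c ` e |e. e \<in> edges G \<and> card (c ` e) = 2}\<rparr>)"

definition connected_components :: "'a graph \<Rightarrow> 'a graph set" where
  "connected_components G =
    (\<lambda>u. induced G {v. (u, v) \<in> {(x, y). {x, y} \<in> edges G}\<^sup>*}) ` verts G"

definition perfect_matching :: "'a graph \<Rightarrow> 'a set set \<Rightarrow> bool" where
  "perfect_matching G M \<longleftrightarrow> M \<subseteq> edges G \<and> (\<forall>v\<in>verts G. \<exists>!e. e \<in> M \<and> v \<in> e)"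

definition factorizable :: "'a graph \<Rightarrow> bool" where
  "factorizable G \<longleftrightarrow> (\<exists>M. perfect_matching G M)"

definition saturated :: "'a graph \<Rightarrow> bool" where
  "saturated G \<longleftrightarrow> factorizable G \<and>
    (\<forall>x\<in>verts G. \<forall>y\<in>verts G. x \<noteq> y \<and> {x, y} \<notin> edges G \<longrightarrow>
      card {M. perfect_matching G M} < card {M. perfect_matching (add_edge G x y) M})"

definition allowed_edges :: "'a graph \<Rightarrow> 'a set set" where
  "allowed_edges G = {e \<in> edges G. \<exists>M. perfect_matching G M \<and> e \<in> M}"

definition elementary_components :: "'a graph \<Rightarrow> 'a graph set" where
  "elementary_components G =
    connected_components \<lparr>verts = \<Union>(allowed_edges G), edges = allowed_edges G\<rparr>"

definition factor_components :: "'a graph \<Rightarrow> 'a graph set" where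
  "factor_components G = (\<lambda>H. induced G (verts H)) ` elementary_components G"

definition elementary :: "'a graph \<Rightarrow> bool" where
  "elementary G \<longleftrightarrow> factorizable G \<and> (\<exists>!H. H \<in> elementary_components G)"

definition separating :: "'a graph \<Rightarrow> 'a set \<Rightarrow> bool" where
  "separating G X \<longleftrightarrow> X \<subseteq> verts G \<and>
    (\<forall>H\<in>factor_components G. verts H \<subseteq> X \<or> verts H \<inter> X = {})"

definition factor_critical :: "'a graph \<Rightarrow> bool" where
  "factor_critical G \<longleftrightarrow> verts G \<noteq> {} \<and> (\<forall>v\<in>verts G. factorizable (delete_verts G {v}))"

definition component_le :: "'a graph \<Rightarrow> 'a graph \<Rightarrow> 'a graph \<Rightarrow> bool" where
  "component_le G G1 G2 \<longleftrightarrow> G1 \<in> factor_components G \<and> G2 \<in> factor_components G \<and>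
    (\<exists>X. separating G X \<and> verts G1 \<union> verts G2 \<subseteq> X \<and>
      factor_critical (contract (induced G X) (verts G1)))"

definition canonical_rel :: "'a graph \<Rightarrow> ('a \<times> 'a) set" where
  "canonical_rel G =
    {(u, v). (\<exists>H\<in>factor_components G. u \<in> verts H \<and> v \<in> verts H) \<and>
      (u = v \<or> \<not> factorizable (delete_verts G {u, v}))}"

definition canonical_partition :: "'a graph \<Rightarrow> 'a set set" where
  "canonical_partition G = verts G // canonical_rel G"

text \<open>The tower \<open>T S\<close> is only meaningful for classes \<open>S\<close> of the canonical partition of the foundation.\<close>

definition cathedral :: "'a graph \<Rightarrow> ('a set \<Rightarrow> 'a graph) \<Rightarrow> 'a graph" where
  "cathedral G0 T =
    \<lparr>verts = verts G0 \<union> (\<Union>S\<in>canonical_partition G0. verts (T S)),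
     edges = edges G0 \<union> (\<Union>S\<in>canonical_partition G0. edges (T S)) \<union>
       {{u, v} |u v S. S \<in> canonical_partition G0 \<and> u \<in> S \<and> v \<in> verts (T S)}\<rparr>"

lemma simple_graph_induced: "simple_graph G \<Longrightarrow> simple_graph (induced G X)"
  unfolding simple_graph_def induced_def by auto

lemma simple_graph_contract:
  assumes "simple_graph G" shows "simple_graph (contract G Y)"
  using assms unfolding simple_graph_def contract_def Let_def
  by (auto simp del: image_eqI intro: imageI)

lemma factor_component_verts:
  assumes "H \<in> factor_components G" shows "verts H \<subseteq> verts G"
  using assms unfolding factor_components_def induced_def by auto

lemma canonical_class_subset:
  assumes "S \<in> canonical_partition G" shows "S \<subseteq> verts G"
  using assms factor_component_verts
  unfolding canonical_partition_def quotient_def canonical_rel_def by fastforce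

lemma simple_graph_cathedral:
  assumes G0: "simple_graph G0"
    and T: "\<And>S. S \<in> canonical_partition G0 \<Longrightarrow> simple_graph (T S)"
    and disj: "\<And>S. S \<in> canonical_partition G0 \<Longrightarrow> verts G0 \<inter> verts (T S) = {}"
  shows "simple_graph (cathedral G0 T)"
proof -
  have fin: "finite (canonical_partition G0)"
    using G0 canonical_class_subset
    by (metis PowI finite_Pow_iff finite_subset simple_graph_def subsetI)
  have "card {u, v} = 2 \<and> {u, v} \<subseteq> verts (cathedral G0 T)"
    if "S \<in> canonical_partition G0" "u \<in> S" "v \<in> verts (T S)" for u v S
  proof -
    have "u \<in> verts G0" using canonical_class_subset that by blast
    moreover from this have "u \<noteq> v" using disj that by blast
    ultimately show ?thesis using that by (auto simp: cathedral_def)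
  qed
  then show ?thesis
    using fin G0 T unfolding simple_graph_def by (auto simp: cathedral_def) blast+
qed

end

theory Submission
  imports Defs
begin

text \<open>
  A set of vertices is matchable if it induces a factorizable subgraph. The alternating paths of two
  matchings show that the matchable sets satisfy the exchange property of even delta-matroids, and
  this property alone makes \<open>\<sim>\<close> transitive on an elementary graph.

  Suppose a perfect matching of the cathedral matches a nonempty set \<open>A\<close> of foundation vertices into
  the towers. Towers have even order, so \<open>A\<close> meets every class of the canonical partition in an even
  number of vertices. As the foundation is saturated, equivalent vertices are adjacent; matching
  pairs of equivalent vertices of \<open>A\<close> with each other until only one pair \<open>u \<sim> v\<close> is left
  contradicts \<open>u \<sim> v\<close>. Hence no edge between the foundation and a tower is allowed. For the
  minimality of the foundation, the whole vertex set serves as the separating set.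
\<close>

section \<open>Matchable sets\<close>

text \<open>A perfect matching of the graph that \<open>E\<close> induces on \<open>X\<close>,
  written as the involution that sends each vertex to its partner. Values outside \<open>X\<close>
  are unconstrained, so matchings of disjoint sets can be glued by a case distinction.\<close>

definition matching_fun :: "'a set set \<Rightarrow> 'a set \<Rightarrow> ('a \<Rightarrow> 'a) \<Rightarrow> bool" where
  "matching_fun E X f \<longleftrightarrow> (\<forall>x\<in>X. f x \<in> X \<and> f x \<noteq> x \<and> f (f x) = x \<and> {x, f x} \<in> E)"

definition matchable :: "'a set set \<Rightarrow> 'a set \<Rightarrow> bool" where
  "matchable E X \<longleftrightarrow> (\<exists>f. matching_fun E X f)"

lemma matching_fun_mono: "matching_fun E X f \<Longrightarrow> E \<subseteq> E' \<Longrightarrow> matching_fun E' X f"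
  unfolding matching_fun_def by blast

lemma matchable_mono: "matchable E X \<Longrightarrow> E \<subseteq> E' \<Longrightarrow> matchable E' X"
  unfolding matchable_def using matching_fun_mono by blast

lemma matchable_empty [simp]: "matchable E {}"
  unfolding matchable_def matching_fun_def by simp

lemma matchable_edge: "{a, b} \<in> E \<Longrightarrow> a \<noteq> b \<Longrightarrow> matchable E {a, b}"
  unfolding matchable_def matching_fun_def
  by (rule exI[of _ "\<lambda>x. if x = a then b else a"]) (auto simp: insert_commute)

lemma matchable_Un:
  assumes "matchable E X" "matchable E Y" "X \<inter> Y = {}"
  shows "matchable E (X \<union> Y)"
proof -
  obtain f g where "matching_fun E X f" "matching_fun E Y g"
    using assms unfolding matchable_def by blast
  then have "matching_fun E (X \<union> Y) (\<lambda>x. if x \<in> X then f x else g x)"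
    using assms(3) unfolding matching_fun_def by (auto simp: disjoint_iff)
  then show ?thesis unfolding matchable_def by blast
qed

lemma matchable_insert_edge:
  assumes "matchable E X" "{a, b} \<in> E" "a \<noteq> b" "a \<notin> X" "b \<notin> X"
  shows "matchable E (X \<union> {a, b})"
  using assms by (intro matchable_Un matchable_edge) auto

lemma matchable_UN:
  assumes "\<And>i. i \<in> I \<Longrightarrow> matchable E (X i)" "disjoint_family_on X I" "finite I"
  shows "matchable E (\<Union>i\<in>I. X i)"
  using assms(3,1,2)
proof (induction I rule: finite_induct)
  case (insert i I)
  have "disjoint_family_on X I"
    using insert.prems(2) by (rule disjoint_family_on_mono[rotated]) blast
  moreover have "X i \<inter> (\<Union>j\<in>I. X j) = {}"
    using insert.prems(2) insert.hyps(2) unfolding disjoint_family_on_def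
    by (auto simp: disjoint_iff)
  ultimately show ?case using insert matchable_Un[of E "X i" "\<Union>j\<in>I. X j"] by simp
qed simp

text \<open>The pairs \<open>{x, f x}\<close> partition \<open>X\<close> into sets of size
  two.\<close>

lemma matching_fun_even_card:
  assumes "matching_fun E X f" "finite X"
  shows "even (card X)"
proof -
  have "X = \<Union>((\<lambda>x. {x, f x}) ` X)"
    using assms(1) unfolding matching_fun_def by auto
  moreover have "2 dvd card (\<Union>((\<lambda>x. {x, f x}) ` X))"
  proof (rule dvd_partition)
    show "finite (\<Union>((\<lambda>x. {x, f x}) ` X))" using assms(2) by blast
    show "\<forall>c\<in>(\<lambda>x. {x, f x}) ` X. 2 dvd card c"
      using assms(1) unfolding matching_fun_def by (auto simp: card_insert_if)
    show "\<forall>c\<in>(\<lambda>x. {x, f x}) ` X. \<forall>d\<in>(\<lambda>x. {x, f x}) ` X. c \<noteq> d \<longrightarrow> c \<inter> d = {}"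
      using assms(1) unfolding matching_fun_def by (auto simp: insert_commute) (metis+)
  qed
  ultimately show ?thesis by simp
qed

lemma matching_fun_remove_pair:
  assumes "matching_fun E X f" "x \<in> X"
  shows "matching_fun E (X - {x, f x}) f"
  using assms unfolding matching_fun_def by (auto, metis+)

section \<open>The exchange property\<close>

text \<open>The two involutions stand for two matchings, with the missed vertices as fixed points;
  \<open>C\<close> is the vertex set of the alternating path that starts at \<open>v\<close>, and \<open>w\<close> is its other end.\<close>

lemma involution_path:
  assumes "finite V" "v \<in> V" "k v = v"
    and "\<And>z. z \<in> V \<Longrightarrow> k z \<in> V \<and> k (k z) = z" "\<And>z. z \<in> V \<Longrightarrow> l z \<in> V \<and> l (l z) = z"
  obtains C w where "C \<subseteq> V" "v \<in> C" "w \<in> C" "k ` C \<subseteq> C" "l ` C \<subseteq> C"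
    "w \<noteq> v \<and> {z \<in> C. k z = z} = {v, w} \<and> {z \<in> C. l z = z} = {} \<or>
     {z \<in> C. k z = z} = {v} \<and> {z \<in> C. l z = z} = {w}"
  using assms
proof (induction "card V" arbitrary: V v k l thesis rule: less_induct)
  case less
  show ?case
  proof (cases "l v = v")
    case True
    \<comment> \<open>The path consists of \<open>v\<close> alone, so \<open>w = v\<close> and the
      second alternative holds.\<close>
    show ?thesis by (rule less.prems(1)[of "{v}" v]) (use True less.prems in auto)
  next
    case False
    \<comment> \<open>Follow the path for one step. Once \<open>v\<close> is deleted,
      \<open>u\<close> has lost its \<open>l\<close>-partner, which \<open>l(u := u)\<close>
      records. So \<open>u\<close> starts a shorter alternating path, on which \<open>l\<close> and
      \<open>k\<close> have exchanged roles.\<close>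
    define u where "u = l v"
    have u: "u \<in> V" "u \<noteq> v" "l u = v"
      using less.prems(3,6) False unfolding u_def by auto
    have lv: "l v = u" unfolding u_def ..
    have k: "k z \<in> V - {v} \<and> k (k z) = z" if "z \<in> V - {v}" for z
      using that less.prems(4) less.prems(5)[of z] by auto
    have l: "(l(u := u)) z \<in> V - {v} \<and> (l(u := u)) ((l(u := u)) z) = z" if "z \<in> V - {v}" for z
      using that u lv less.prems(6)[of z] by auto
    obtain C w where C: "C \<subseteq> V - {v}" "u \<in> C" "w \<in> C" "(l(u := u)) ` C \<subseteq> C" "k ` C \<subseteq> C"
      "w \<noteq> u \<and> {z \<in> C. (l(u := u)) z = z} = {u, w} \<and> {z \<in> C. k z = z} = {} \<or>
       {z \<in> C. (l(u := u)) z = z} = {u} \<and> {z \<in> C. k z = z} = {w}"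
    proof (rule less.hyps[of "V - {v}" u "l(u := u)" k])
      show "card (V - {v}) < card V"
        using less.prems(2,3) by (rule card_Diff1_less)
    qed (use less.prems(2) u k l in auto)
    have vC: "v \<notin> C" using C(1) by blast
    have kfix: "{z \<in> insert v C. k z = z} = insert v {z \<in> C. k z = z}"
      using less.prems(4) by auto
    have lfix: "{z \<in> insert v C. l z = z} = {z \<in> C. (l(u := u)) z = z} - {u}"
      using u lv by auto
    \<comment> \<open>The exchange of roles swaps the two alternatives: \<open>v\<close> comes in as
      a new fixed point of \<open>k\<close>, and \<open>u\<close> ceases to be a fixed point when
      \<open>l\<close> is restored.\<close>
    have ends: "w \<noteq> v \<and> insert v K = {v, w} \<and> L - {u} = {} \<or> insert v K = {v} \<and> L - {u} = {w}"
      if "w \<noteq> u \<and> L = {u, w} \<and> K = {} \<or> L = {u} \<and> K = {w}" for K L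
      using that C(3) vC by (elim disjE conjE) auto
    show ?thesis
    proof (rule less.prems(1)[of "insert v C" w])
      show "k ` insert v C \<subseteq> insert v C" using C(5) less.prems(4) by auto
      show "l ` insert v C \<subseteq> insert v C"
      proof -
        have "l z \<in> insert v C" if "z \<in> C" for z
          using that C(4) u(3) by (cases "z = u") (auto simp: image_subset_iff)
        then show ?thesis using C(2) lv by auto
      qed
      show "w \<noteq> v \<and> {z \<in> insert v C. k z = z} = {v, w} \<and> {z \<in> insert v C. l z = z} = {} \<or>
        {z \<in> insert v C. k z = z} = {v} \<and> {z \<in> insert v C. l z = z} = {w}"
        unfolding kfix lfix by (rule ends[OF C(6)])
      show "insert v C \<subseteq> V" using C(1) less.prems(3) by blast
    qed (use C(3) in simp_all)
  qed
qed

text \<open>Both matchings are involutions, so neither has an edge leaving \<open>C\<close>. Using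
  \<open>g\<close> inside \<open>C\<close> and \<open>f\<close> outside is therefore
  consistent.\<close>

lemma matchable_switch:
  assumes "matching_fun E X f" "matching_fun E Y g"
    and "\<And>z. z \<in> C \<Longrightarrow> z \<in> X \<Longrightarrow> f z \<in> C" "\<And>z. z \<in> C \<Longrightarrow> z \<in> Y \<Longrightarrow> g z \<in> C"
  shows "matchable E (X - C \<union> Y \<inter> C)"
proof -
  have "f z \<notin> C" if "z \<in> X - C" for z
    using that assms(1,3) unfolding matching_fun_def by (metis Diff_iff)
  then have "matching_fun E (X - C \<union> Y \<inter> C) (\<lambda>z. if z \<in> C then g z else f z)"
    using assms unfolding matching_fun_def by auto
  then show ?thesis unfolding matchable_def by blast
qed

text \<open>The vertex \<open>v\<close> is missed by a matching of \<open>X\<close>, so its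
  component in the union of the two matchings is a path starting at \<open>v\<close>. Switching
  along this path toggles exactly its two ends, and the same \<open>w\<close> serves both
  sets.\<close>

lemma matchable_exchange:
  assumes "finite X" "finite Y" "matchable E X" "matchable E Y" "v \<in> Y - X"
  obtains w where "w \<in> sym_diff X Y - {v}"
    "matchable E (sym_diff X {v, w})" "matchable E (sym_diff Y {v, w})"
proof -
  obtain f g where f: "matching_fun E X f" and g: "matching_fun E Y g"
    using assms(3,4) unfolding matchable_def by blast
  define k where "k z = (if z \<in> X then f z else z)" for z
  define l where "l z = (if z \<in> Y then g z else z)" for z
  have "k v = v" using assms(5) unfolding k_def by simp
  have k: "k z \<in> X \<union> Y \<and> k (k z) = z" if "z \<in> X \<union> Y" for z
    using f that unfolding k_def matching_fun_def by auto
  have l: "l z \<in> X \<union> Y \<and> l (l z) = z" if "z \<in> X \<union> Y" for z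
    using g that unfolding l_def matching_fun_def by auto
  have kfix: "k z = z \<longleftrightarrow> z \<notin> X" for z
    using f unfolding k_def matching_fun_def by auto
  have lfix: "l z = z \<longleftrightarrow> z \<notin> Y" for z
    using g unfolding l_def matching_fun_def by auto
  obtain C w where C: "C \<subseteq> X \<union> Y" "v \<in> C" "w \<in> C" "k ` C \<subseteq> C" "l ` C \<subseteq> C"
    "w \<noteq> v \<and> {z \<in> C. k z = z} = {v, w} \<and> {z \<in> C. l z = z} = {} \<or>
     {z \<in> C. k z = z} = {v} \<and> {z \<in> C. l z = z} = {w}"
    by (rule involution_path[of "X \<union> Y" v k l]) (use assms k l \<open>k v = v\<close> in auto)
  have fC: "f z \<in> C" if "z \<in> C" "z \<in> X" for z
    using C(4) that unfolding k_def by force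
  have gC: "g z \<in> C" if "z \<in> C" "z \<in> Y" for z
    using C(5) that unfolding l_def by force
  \<comment> \<open>Fixed points of \<open>k\<close> and \<open>l\<close> are the vertices missed by
    the respective matching, so the only vertices of the path that lie outside \<open>X\<close> or
    outside \<open>Y\<close> are its ends.\<close>
  have ends: "w \<noteq> v \<and> C - X = {v, w} \<and> C - Y = {} \<or> C - X = {v} \<and> C - Y = {w}"
    using C(6) unfolding kfix lfix by (simp add: set_diff_eq)
  then have D: "(C - X) \<union> (C - Y) = {v, w}" by (elim disjE conjE) auto
  \<comment> \<open>In the second alternative \<open>w\<close> lies outside \<open>Y\<close>,
    whereas \<open>v\<close> lies in \<open>Y\<close>.\<close>
  have "w \<noteq> v" using ends assms(5) by (elim disjE conjE) auto
  moreover have "w \<in> (C - X) \<union> (C - Y)" unfolding D by simp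
  ultimately have w: "w \<in> sym_diff X Y - {v}" using C(1) by blast
  show ?thesis
  proof (rule that[OF w])
    have "X - C \<union> Y \<inter> C = sym_diff X {v, w}"
      unfolding D[symmetric] using C(1) by blast
    then show "matchable E (sym_diff X {v, w})"
      using matchable_switch[OF f g fC gC] by simp
    have "Y - C \<union> X \<inter> C = sym_diff Y {v, w}"
      unfolding D[symmetric] using C(1) by blast
    then show "matchable E (sym_diff Y {v, w})"
      using matchable_switch[OF g f gC fC] by simp
  qed
qed

section \<open>Matchings, allowed edges and saturation\<close>

lemma perfect_matchingD:
  assumes "perfect_matching G M"
  shows "M \<subseteq> edges G" and "v \<in> verts G \<Longrightarrow> \<exists>e\<in>M. v \<in> e"
    and "v \<in> verts G \<Longrightarrow> e \<in> M \<Longrightarrow> e' \<in> M \<Longrightarrow> v \<in> e \<Longrightarrow> v \<in> e' \<Longrightarrow> e = e'"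
  using assms unfolding perfect_matching_def by (simp, meson, metis)

text \<open>The involution runs along \<open>M\<close> itself and not merely along
  \<open>edges G\<close>, so that a given edge of \<open>M\<close> at \<open>x\<close> can be
  identified with \<open>{x, f x}\<close>.\<close>

lemma perfect_matching_imp_matching_fun:
  assumes "simple_graph G" "perfect_matching G M"
  obtains f where "matching_fun M (verts G) f"
proof -
  have *: "\<exists>y. y \<in> verts G \<and> y \<noteq> x \<and> {x, y} \<in> M" if x: "x \<in> verts G" for x
  proof -
    obtain e where e: "e \<in> M" "x \<in> e" using perfect_matchingD(2)[OF assms(2) x] by blast
    then have "e \<subseteq> verts G" "card e = 2"
      using assms(1) perfect_matchingD(1)[OF assms(2)] unfolding simple_graph_def by auto
    then obtain y where "e = {x, y}" "y \<noteq> x" using e(2) by (auto simp: card_2_iff)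
    then show ?thesis using e \<open>e \<subseteq> verts G\<close> by auto
  qed
  obtain f where f: "\<forall>x\<in>verts G. f x \<in> verts G \<and> f x \<noteq> x \<and> {x, f x} \<in> M"
    using bchoice[of "verts G" "\<lambda>x y. y \<in> verts G \<and> y \<noteq> x \<and> {x, y} \<in> M"] * by blast
  have "f (f x) = x" if "x \<in> verts G" for x
  proof -
    have "{f x, f (f x)} \<in> M" "{x, f x} \<in> M" "f x \<in> verts G" using f that by auto
    then have "{f x, f (f x)} = {x, f x}"
      using perfect_matchingD(3)[OF assms(2), of "f x"] by blast
    then show ?thesis using f that by (auto simp: doubleton_eq_iff)
  qed
  then show ?thesis using that f unfolding matching_fun_def by blast
qed

lemma matching_fun_imp_perfect_matching:
  assumes "matching_fun (edges G) (verts G) f"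
  shows "perfect_matching G ((\<lambda>x. {x, f x}) ` verts G)"
proof -
  have *: "e = {v, f v}" if "v \<in> verts G" "x \<in> verts G" "e = {x, f x}" "v \<in> e" for v x e
  proof -
    have "v = x \<or> v = f x" using that(3,4) by blast
    moreover have "f (f x) = x" using that(2) assms unfolding matching_fun_def by blast
    ultimately show ?thesis using that(3) by (elim disjE) (simp_all add: insert_commute)
  qed
  have "\<exists>!e. e \<in> (\<lambda>x. {x, f x}) ` verts G \<and> v \<in> e" if v: "v \<in> verts G" for v
  proof (rule ex1I)
    show "{v, f v} \<in> (\<lambda>x. {x, f x}) ` verts G \<and> v \<in> {v, f v}" using v by simp
    fix e assume "e \<in> (\<lambda>x. {x, f x}) ` verts G \<and> v \<in> e"
    then obtain x where "x \<in> verts G" "e = {x, f x}" "v \<in> e" by (elim conjE imageE)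
    then show "e = {v, f v}" using *[OF v] by blast
  qed
  moreover have "(\<lambda>x. {x, f x}) ` verts G \<subseteq> edges G"
    using assms unfolding matching_fun_def by auto
  ultimately show ?thesis unfolding perfect_matching_def by blast
qed

lemma factorizable_iff_matchable:
  assumes "simple_graph G"
  shows "factorizable G \<longleftrightarrow> matchable (edges G) (verts G)"
proof
  assume "factorizable G"
  then obtain M where M: "perfect_matching G M" unfolding factorizable_def by blast
  obtain f where "matching_fun M (verts G) f"
    using assms M by (rule perfect_matching_imp_matching_fun)
  moreover have "M \<subseteq> edges G" using M unfolding perfect_matching_def by blast
  ultimately show "matchable (edges G) (verts G)"
    using matching_fun_mono unfolding matchable_def by blast
next
  assume "matchable (edges G) (verts G)"
  then obtain f where "matching_fun (edges G) (verts G) f" unfolding matchable_def by blast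
  then show "factorizable G"
    unfolding factorizable_def using matching_fun_imp_perfect_matching by metis
qed

lemma factorizable_delete_iff_matchable:
  assumes "simple_graph G"
  shows "factorizable (delete_verts G A) \<longleftrightarrow> matchable (edges G) (verts G - A)"
proof -
  have "simple_graph (delete_verts G A)"
    using assms simple_graph_induced unfolding delete_verts_def by blast
  moreover have "verts (delete_verts G A) = verts G - A"
    unfolding delete_verts_def induced_def by auto
  moreover have "matching_fun (edges (delete_verts G A)) (verts G - A) f
      \<longleftrightarrow> matching_fun (edges G) (verts G - A) f" for f
    unfolding matching_fun_def delete_verts_def induced_def by auto
  ultimately show ?thesis
    using factorizable_iff_matchable unfolding matchable_def by metis
qed

text \<open>Deleting both ends of the edge turns a matching through it into a matching of the rest.
  The edge is also taken out of the edge set, so that for \<open>add_edge G x y\<close> with a new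
  edge the right-hand side speaks of the edges of \<open>G\<close> only.\<close>

lemma perfect_matching_with_edge:
  assumes G: "simple_graph G" and xy: "x \<in> verts G" "y \<in> verts G" "x \<noteq> y"
  shows "(\<exists>M. perfect_matching G M \<and> {x, y} \<in> M)
    \<longleftrightarrow> {x, y} \<in> edges G \<and> matchable (edges G - {{x, y}}) (verts G - {x, y})"
proof
  assume "\<exists>M. perfect_matching G M \<and> {x, y} \<in> M"
  then obtain M where M: "perfect_matching G M" "{x, y} \<in> M" by blast
  obtain f where f: "matching_fun M (verts G) f"
    using G M(1) by (rule perfect_matching_imp_matching_fun)
  have "f x = y"
    using f perfect_matchingD(3)[OF M(1) xy(1) _ M(2), of "{x, f x}"] xy
    unfolding matching_fun_def by (auto simp: doubleton_eq_iff)
  then have "matching_fun M (verts G - {x, y}) f"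
    using matching_fun_remove_pair[OF f xy(1)] by simp
  then have "matching_fun (edges G - {{x, y}}) (verts G - {x, y}) f"
    using perfect_matchingD(1)[OF M(1)] unfolding matching_fun_def by auto
  then show "{x, y} \<in> edges G \<and> matchable (edges G - {{x, y}}) (verts G - {x, y})"
    using M(2) perfect_matchingD(1)[OF M(1)] unfolding matchable_def by blast
next
  assume *: "{x, y} \<in> edges G \<and> matchable (edges G - {{x, y}}) (verts G - {x, y})"
  then obtain f where f: "matching_fun (edges G - {{x, y}}) (verts G - {x, y}) f"
    unfolding matchable_def by blast
  define g where "g = f(x := y, y := x)"
  have "g z \<in> verts G \<and> g z \<noteq> z \<and> g (g z) = z \<and> {z, g z} \<in> edges G" if "z \<in> verts G" for z
  proof (cases "z \<in> {x, y}")
    case True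
    then show ?thesis using * xy unfolding g_def by (auto simp: insert_commute)
  next
    case False
    then have "f z \<in> verts G - {x, y}" "f z \<noteq> z" "f (f z) = z" "{z, f z} \<in> edges G"
      using f that unfolding matching_fun_def by auto
    then show ?thesis using False unfolding g_def by auto
  qed
  then have "matching_fun (edges G) (verts G) g" unfolding matching_fun_def by blast
  then have "perfect_matching G ((\<lambda>x. {x, g x}) ` verts G)"
    by (rule matching_fun_imp_perfect_matching)
  moreover have "{x, y} \<in> (\<lambda>x. {x, g x}) ` verts G"
    using xy by (intro image_eqI[of _ _ x]) (auto simp: g_def)
  ultimately show "\<exists>M. perfect_matching G M \<and> {x, y} \<in> M" by blast
qed

lemma matchable_Diff_edge:
  "matchable (E - {{x, y}}) (X - {x, y}) \<longleftrightarrow> matchable E (X - {x, y})"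
  unfolding matchable_def matching_fun_def by auto

lemma simple_graph_edgeD:
  assumes "simple_graph G" "{x, y} \<in> edges G"
  shows "x \<in> verts G" "y \<in> verts G" "x \<noteq> y"
  using assms unfolding simple_graph_def by force+

lemma allowed_edges_iff:
  assumes "simple_graph G"
  shows "{x, y} \<in> allowed_edges G \<longleftrightarrow> {x, y} \<in> edges G \<and> matchable (edges G) (verts G - {x, y})"
proof (cases "{x, y} \<in> edges G")
  case True
  then show ?thesis
    using perfect_matching_with_edge[OF assms simple_graph_edgeD[OF assms True]]
    unfolding allowed_edges_def matchable_Diff_edge by auto
qed (simp add: allowed_edges_def)

lemma Union_allowed_edges:
  assumes "simple_graph G" "factorizable G"
  shows "\<Union>(allowed_edges G) = verts G"
proof
  show "\<Union>(allowed_edges G) \<subseteq> verts G"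
    using assms(1) unfolding allowed_edges_def simple_graph_def by blast
  show "verts G \<subseteq> \<Union>(allowed_edges G)"
    using assms(2) perfect_matchingD(1,2) unfolding allowed_edges_def factorizable_def by fast
qed

text \<open>For nonadjacent \<open>x\<close> and \<open>y\<close>, the perfect matchings of the
  enlarged graph are those of \<open>G\<close> together with those through the new edge. Their
  number grows exactly if some matching uses the new edge, and this means that the graph without
  \<open>x\<close> and \<open>y\<close> has a perfect matching.\<close>

lemma saturated_iff:
  assumes G: "simple_graph G"
  shows "saturated G \<longleftrightarrow> matchable (edges G) (verts G) \<and>
    (\<forall>x\<in>verts G. \<forall>y\<in>verts G. x \<noteq> y \<and> {x, y} \<notin> edges G \<longrightarrow>
      matchable (edges G) (verts G - {x, y}))"
proof -
  have "card {M. perfect_matching G M} < card {M. perfect_matching (add_edge G x y) M}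
      \<longleftrightarrow> matchable (edges G) (verts G - {x, y})"
    if xy: "x \<in> verts G" "y \<in> verts G" "x \<noteq> y" "{x, y} \<notin> edges G" for x y
  proof -
    have ve: "verts (add_edge G x y) = verts G" "edges (add_edge G x y) = insert {x, y} (edges G)"
      unfolding add_edge_def by auto
    have G': "simple_graph (add_edge G x y)"
      using G xy unfolding simple_graph_def ve by auto
    \<comment> \<open>Infinite sets have \<open>card\<close> 0, so comparing the two numbers
      requires finiteness.\<close>
    have "finite (edges (add_edge G x y))"
      using G' unfolding simple_graph_def by (meson PowI finite_Pow_iff finite_subset subsetI)
    then have fin: "finite {M. perfect_matching (add_edge G x y) M}"
      by (rule finite_subset[rotated, OF finite_Pow_iff[THEN iffD2]])
        (auto simp: perfect_matching_def)
    have eq: "{M. perfect_matching (add_edge G x y) M} = {M. perfect_matching G M} \<union>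
        {M. perfect_matching (add_edge G x y) M \<and> {x, y} \<in> M}"
      unfolding perfect_matching_def ve by auto
    have disj: "{M. perfect_matching G M} \<inter>
        {M. perfect_matching (add_edge G x y) M \<and> {x, y} \<in> M} = {}"
      using xy(4) unfolding perfect_matching_def by auto
    have "card {M. perfect_matching (add_edge G x y) M} = card {M. perfect_matching G M} +
        card {M. perfect_matching (add_edge G x y) M \<and> {x, y} \<in> M}"
      using fin disj unfolding eq by (intro card_Un_disjoint) auto
    then have "card {M. perfect_matching G M} < card {M. perfect_matching (add_edge G x y) M}
        \<longleftrightarrow> card {M. perfect_matching (add_edge G x y) M \<and> {x, y} \<in> M} > 0"
      by simp
    also have "\<dots> \<longleftrightarrow> (\<exists>M. perfect_matching (add_edge G x y) M \<and> {x, y} \<in> M)"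
      using fin by (auto simp: card_gt_0_iff)
    also have "\<dots> \<longleftrightarrow> matchable (insert {x, y} (edges G) - {{x, y}}) (verts G - {x, y})"
      using perfect_matching_with_edge[OF G', of x y] xy unfolding ve by simp
    finally show ?thesis unfolding matchable_Diff_edge using matchable_Diff_edge xy(4)
      by (metis Diff_insert_absorb)
  qed
  then show ?thesis
    using factorizable_iff_matchable[OF G] unfolding saturated_def by blast
qed

lemma saturatedD:
  assumes "simple_graph G" "saturated G"
  shows "matchable (edges G) (verts G)"
    and "x \<in> verts G \<Longrightarrow> y \<in> verts G \<Longrightarrow> x \<noteq> y \<Longrightarrow> {x, y} \<notin> edges G \<Longrightarrow>
      matchable (edges G) (verts G - {x, y})"
  using assms(2) unfolding saturated_iff[OF assms(1)] by auto

section \<open>The canonical partition of an elementary graph\<close>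

text \<open>Allowed edges cover all vertices of a factorizable graph, so uniqueness of the
  elementary component makes the allowed edges connect everything. Existence of a component excludes
  the empty graph.\<close>

lemma elementary_connected:
  assumes "simple_graph G" "elementary G"
  shows "verts G \<noteq> {}"
    and "\<And>u v. u \<in> verts G \<Longrightarrow> v \<in> verts G \<Longrightarrow> (u, v) \<in> {(x, y). {x, y} \<in> allowed_edges G}\<^sup>*"
proof -
  have V: "\<Union>(allowed_edges G) = verts G"
    using assms Union_allowed_edges unfolding elementary_def by blast
  obtain H where H: "elementary_components G = {H}"
    using assms(2) unfolding elementary_def by blast
  then show "verts G \<noteq> {}"
    unfolding elementary_components_def connected_components_def V by auto
  fix u v assume uv: "u \<in> verts G" "v \<in> verts G"
  define c where "c u = induced \<lparr>verts = verts G, edges = allowed_edges G\<rparr>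
    {v. (u, v) \<in> {(x, y). {x, y} \<in> allowed_edges G}\<^sup>*}" for u
  have "c ` verts G = {H}"
    using H unfolding elementary_components_def connected_components_def V c_def by simp
  then have "c u = c v" using uv by (metis imageI singletonD)
  moreover have "v \<in> verts (c v)" using uv(2) unfolding c_def induced_def by simp
  ultimately have "v \<in> verts (c u)" by simp
  then show "(u, v) \<in> {(x, y). {x, y} \<in> allowed_edges G}\<^sup>*" unfolding c_def induced_def by simp
qed

text \<open>The only factor-connected component spans all vertices, which reduces the same-component
  condition to membership in \<open>verts G\<close>.\<close>

lemma canonical_rel_elementary:
  assumes "simple_graph G" "elementary G"
  shows "(u, v) \<in> canonical_rel G \<longleftrightarrow> u \<in> verts G \<and> v \<in> verts G \<and>
    (u = v \<or> \<not> matchable (edges G) (verts G - {u, v}))"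
proof -
  have V: "\<Union>(allowed_edges G) = verts G"
    using assms Union_allowed_edges unfolding elementary_def by blast
  have "verts H = verts G" if "H \<in> factor_components G" for H
    using that elementary_connected(2)[OF assms]
    unfolding factor_components_def elementary_components_def connected_components_def V induced_def
    by auto
  moreover have "factor_components G \<noteq> {}"
    using elementary_connected(1)[OF assms]
    unfolding factor_components_def elementary_components_def connected_components_def V by simp
  ultimately show ?thesis
    using factorizable_delete_iff_matchable[OF assms(1)] unfolding canonical_rel_def by auto
qed

text \<open>Transitivity of \<open>\<sim>\<close> at \<open>x\<close>, given a neighbour
  \<open>d\<close> of \<open>u\<close> that is not equivalent to \<open>x\<close>. Exchanging at
  \<open>v\<close> between \<open>V - {u, v}\<close> and \<open>V - {x, d}\<close> leaves
  \<open>u\<close>, \<open>x\<close> or \<open>d\<close> as the second toggled vertex. Each choice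
  makes \<open>V - {x, u}\<close> or \<open>V - {x, v}\<close> matchable, for \<open>u\<close> after
  adding the edge \<open>{u, d}\<close>.\<close>

lemma canonical_rel_step:
  assumes fin: "finite V"
    and xu: "\<not> matchable E (V - {x, u})" and xv: "\<not> matchable E (V - {x, v})"
    and xd: "matchable E (V - {x, d})" and ud: "{u, d} \<in> E"
    and mem: "x \<in> V" "u \<in> V" "v \<in> V" "d \<in> V" and neq: "u \<noteq> x" "v \<noteq> x" "d \<noteq> x" "u \<noteq> v"
  shows "\<not> matchable E (V - {u, v})"
proof
  assume uv: "matchable E (V - {u, v})"
  \<comment> \<open>Removing \<open>x\<close> and \<open>d\<close> leaves a matchable set; removing
    \<open>x\<close> and \<open>u\<close>, or \<open>x\<close> and \<open>v\<close>, does
    not.\<close>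
  have dn: "d \<noteq> u" "d \<noteq> v" using xu xv xd by auto
  have "v \<in> (V - {x, d}) - (V - {u, v})" using mem neq dn by auto
  then obtain w where w: "w \<in> sym_diff (V - {u, v}) (V - {x, d}) - {v}"
    and Ku: "matchable E (sym_diff (V - {u, v}) {v, w})"
    and Lu: "matchable E (sym_diff (V - {x, d}) {v, w})"
    using matchable_exchange[of "V - {u, v}" "V - {x, d}" E v] fin uv xd by auto
  then consider "w = u" | "w = x" | "w = d" by auto
  then show False
  proof cases
    case 1
    then have "sym_diff (V - {x, d}) {v, w} = V - {x, d, u, v}" using mem neq dn by auto
    then have "matchable E (V - {x, d, u, v} \<union> {u, d})"
      using Lu ud dn by (intro matchable_insert_edge) auto
    moreover have "V - {x, d, u, v} \<union> {u, d} = V - {x, v}" using mem neq dn by auto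
    ultimately show False using xv by simp
  next
    case 2
    then have "sym_diff (V - {u, v}) {v, w} = V - {x, u}" using mem neq by auto
    then show False using Ku xu by simp
  next
    case 3
    then have "sym_diff (V - {x, d}) {v, w} = V - {x, v}" using mem neq dn by auto
    then show False using Lu xv by simp
  qed
qed

lemma equiv_canonical_rel:
  assumes G: "simple_graph G" "elementary G"
  shows "equiv (verts G) (canonical_rel G)"
proof (rule equivI)
  note rel = canonical_rel_elementary[OF G]
  define E V where "E = edges G" and "V = verts G"
  have fin: "finite V" using G(1) unfolding simple_graph_def V_def by blast
  show "canonical_rel G \<subseteq> verts G \<times> verts G" using rel by auto
  show "refl_on (verts G) (canonical_rel G)" using rel by (auto simp: refl_on_def)
  show sym: "sym (canonical_rel G)" using rel by (auto simp: sym_def insert_commute)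
  \<comment> \<open>This provides the neighbour \<open>d\<close> that
    \<open>canonical_rel_step\<close> asks for. It is found by walking from \<open>x\<close> to
    \<open>u\<close> along allowed edges; the disjunction below is the invariant of the
    walk.\<close>
  have adj: "\<exists>d\<in>V. d \<noteq> x \<and> {u, d} \<in> E \<and> matchable E (V - {x, d})"
    if xu: "x \<in> V" "u \<in> V" "u \<noteq> x" "\<not> matchable E (V - {x, u})" for x u
  proof -
    have "u = x \<or> matchable E (V - {x, u}) \<or>
        (\<exists>d\<in>V. d \<noteq> x \<and> {u, d} \<in> E \<and> matchable E (V - {x, d}))"
      if "(x, u) \<in> {(x, y). {x, y} \<in> allowed_edges G}\<^sup>*" for u
      using that
    proof (induction rule: rtrancl_induct)
      case (step a c)
      have ac: "{a, c} \<in> E" "matchable E (V - {a, c})" "a \<in> V" "c \<in> V" "a \<noteq> c"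
        using step.hyps(2) allowed_edges_iff[OF G(1)] simple_graph_edgeD[OF G(1), of a c]
        unfolding E_def V_def by auto
      \<comment> \<open>Suppose the invariant fails at \<open>c\<close>. Then \<open>a\<close> is
        not \<open>x\<close>, since \<open>{a, c}\<close> is allowed, and \<open>a\<close> is
        equivalent to \<open>x\<close>, since otherwise \<open>a\<close> would be the required
        neighbour of \<open>c\<close>. The neighbour of \<open>a\<close> given by induction then
        makes \<open>a\<close> and \<open>c\<close> equivalent, which is impossible for the ends of
        an allowed edge.\<close>
      show ?case
      proof (rule ccontr)
        assume *: "\<not> ?case"
        have "a \<noteq> x" using * ac by auto
        moreover have "\<not> matchable E (V - {x, a})"
          using * ac \<open>a \<noteq> x\<close> by (auto simp: insert_commute)
        ultimately obtain d where "d \<in> V" "d \<noteq> x" "{a, d} \<in> E" "matchable E (V - {x, d})"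
          using step.IH by blast
        then have "\<not> matchable E (V - {a, c})"
          using canonical_rel_step[OF fin, of E x a c d] * xu(1) ac \<open>a \<noteq> x\<close>
            \<open>\<not> matchable E (V - {x, a})\<close> by auto
        then show False using ac by blast
      qed
    qed auto
    then show ?thesis
      using elementary_connected(2)[OF G, of x u] xu unfolding V_def by blast
  qed
  show "trans (canonical_rel G)"
  proof (rule transI)
    fix u x v assume ux: "(u, x) \<in> canonical_rel G" and xv: "(x, v) \<in> canonical_rel G"
    show "(u, v) \<in> canonical_rel G"
    proof (cases "u = x \<or> v = x \<or> u = v")
      case True
      then show ?thesis using ux xv rel by auto
    next
      case False
      then have *: "x \<in> V" "u \<in> V" "v \<in> V" "\<not> matchable E (V - {x, u})" "\<not> matchable E (V - {x, v})"
        using ux xv rel unfolding E_def V_def by (auto simp: insert_commute)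
      then obtain d where "d \<in> V" "d \<noteq> x" "{u, d} \<in> E" "matchable E (V - {x, d})"
        using adj False by blast
      then have "\<not> matchable E (V - {u, v})"
        using canonical_rel_step[OF fin, of E x u v d] * False by auto
      then show ?thesis using * rel unfolding E_def V_def by auto
    qed
  qed
qed

text \<open>Induction on \<open>A\<close>: adding an edge between two equivalent vertices of
  \<open>A\<close> to the matching shrinks \<open>A\<close> by two and keeps all parities, until a
  single pair remains.\<close>

lemma saturated_no_even_deficiency:
  assumes G: "simple_graph G" "elementary G" "saturated G"
    and "A \<subseteq> verts G" "matchable (edges G) (verts G - A)"
    and "\<And>S. S \<in> canonical_partition G \<Longrightarrow> even (card (A \<inter> S))"
  shows "A = {}"
proof -
  note rel = canonical_rel_elementary[OF G(1,2)] and eqv = equiv_canonical_rel[OF G(1,2)]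
  have "finite A" using assms(4) G(1) finite_subset unfolding simple_graph_def by blast
  then show ?thesis using assms(4-6)
  proof (induction A rule: finite_psubset_induct)
    case (psubset A)
    show ?case
    proof (rule ccontr)
      assume "A \<noteq> {}"
      then obtain v where v: "v \<in> A" by blast
      define S where "S = canonical_rel G `` {v}"
      have S: "S \<in> canonical_partition G" "v \<in> S"
        using v psubset.prems(1) equiv_class_self[OF eqv]
        unfolding S_def canonical_partition_def by (auto intro: quotientI)
      \<comment> \<open>The intersection has even size and contains \<open>v\<close>, so it has a
        second element.\<close>
      have "A \<inter> S \<noteq> {v}" using psubset.prems(3)[OF S(1)] by auto
      then obtain w where w: "w \<in> A" "w \<in> S" "w \<noteq> v" using S v by blast
      have vw: "v \<in> verts G" "w \<in> verts G" "\<not> matchable (edges G) (verts G - {v, w})"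
        using w rel unfolding S_def by auto
      \<comment> \<open>If \<open>v\<close> and \<open>w\<close> were not adjacent, saturation would
        make \<open>verts G - {v, w}\<close> matchable.\<close>
      then have edge: "{v, w} \<in> edges G"
        using saturatedD(2)[OF G(1,3)] w(3) by metis
      have eq: "verts G - (A - {v, w}) = (verts G - A) \<union> {v, w}" using vw by auto
      have "A - {v, w} = {}"
      proof (rule psubset.IH)
        show "matchable (edges G) (verts G - (A - {v, w}))"
          unfolding eq using psubset.prems(2) edge v w by (intro matchable_insert_edge) auto
        fix S' assume S': "S' \<in> canonical_partition G"
        show "even (card ((A - {v, w}) \<inter> S'))"
        proof (cases "S' = S")
          case True
          have "(A - {v, w}) \<inter> S = A \<inter> S - {v, w}" by blast
          moreover have "card (A \<inter> S - {v, w}) = card (A \<inter> S) - 2"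
            using v w S by (subst card_Diff_subset) auto
          ultimately show ?thesis using True psubset.prems(3)[OF S(1)] by simp
        next
          case False
          then have "S' \<inter> S = {}"
            using quotient_disj[OF eqv] S' S(1) unfolding canonical_partition_def by blast
          then have "(A - {v, w}) \<inter> S' = A \<inter> S'" using S(2) w(2) by blast
          then show ?thesis using psubset.prems(3)[OF S'] by simp
        qed
      qed (use v psubset.prems(1) in auto)
      \<comment> \<open>Matchability outside \<open>A\<close> now says that \<open>v\<close> and
        \<open>w\<close> are not equivalent.\<close>
      then have "A = {v, w}" using v w by blast
      then show False using vw psubset.prems(2) by simp
    qed
  qed
qed

section \<open>The cathedral\<close>

locale cathedral_graph =
  fixes G0 :: "'a graph" and T :: "'a set \<Rightarrow> 'a graph"
  assumes G0: "simple_graph G0" "saturated G0" "elementary G0"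
    and T: "\<And>S. S \<in> canonical_partition G0 \<Longrightarrow> simple_graph (T S)"
      "\<And>S. S \<in> canonical_partition G0 \<Longrightarrow> saturated (T S)"
    and disj0: "\<And>S. S \<in> canonical_partition G0 \<Longrightarrow> verts G0 \<inter> verts (T S) = {}"
    and disj: "disjoint_family_on (\<lambda>S. verts (T S)) (canonical_partition G0)"
begin

abbreviation "P \<equiv> canonical_partition G0"
abbreviation "V0 \<equiv> verts G0"
abbreviation "G \<equiv> cathedral G0 T"
abbreviation "E \<equiv> edges G"

section \<open>Vertices, classes and edges of the cathedral\<close>

lemma simple: "simple_graph G"
  using G0(1) T(1) disj0 by (rule simple_graph_cathedral)

lemma verts_G: "verts G = V0 \<union> (\<Union>S\<in>P. verts (T S))"
  unfolding cathedral_def by simp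

lemma finite_V: "finite (verts G)" "finite V0" "finite P"
proof -
  show "finite (verts G)" "finite V0"
    using simple G0(1) unfolding simple_graph_def by auto
  then show "finite P"
    using canonical_class_subset by (metis PowI finite_Pow_iff finite_subset subsetI)
qed

lemma P_eqv: "equiv V0 (canonical_rel G0)"
  using G0 equiv_canonical_rel by blast

lemma P_disj: "S \<in> P \<Longrightarrow> S' \<in> P \<Longrightarrow> x \<in> S \<Longrightarrow> x \<in> S' \<Longrightarrow> S = S'"
  using quotient_disj[OF P_eqv] unfolding canonical_partition_def by blast

lemma P_nonempty: "S \<in> P \<Longrightarrow> \<exists>s. s \<in> S"
  using in_quotient_imp_non_empty[OF P_eqv] unfolding canonical_partition_def by blast

text \<open>Vertices of different classes are not equivalent. The matching obtained leaves
  \<open>s\<close> free to be joined to a vertex of the tower over \<open>S\<close>.\<close>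

lemma P_apart:
  assumes "S \<in> P" "s \<in> S" "x \<in> V0" "x \<notin> S"
  shows "matchable E (V0 - {x, s})"
proof -
  have "(s, x) \<notin> canonical_rel G0"
    using assms in_quotient_imp_closed[OF P_eqv] unfolding canonical_partition_def by blast
  then have "matchable (edges G0) (V0 - {x, s})"
    using assms canonical_class_subset[OF assms(1)] canonical_rel_elementary[OF G0(1,3)]
    by (auto simp: insert_commute)
  then show ?thesis by (rule matchable_mono) (auto simp: cathedral_def)
qed

lemma tower_disj: "S \<in> P \<Longrightarrow> S' \<in> P \<Longrightarrow> x \<in> verts (T S) \<Longrightarrow> x \<in> verts (T S') \<Longrightarrow> S = S'"
  using disj unfolding disjoint_family_on_def by blast

lemma tower_notin_V0: "S \<in> P \<Longrightarrow> x \<in> verts (T S) \<Longrightarrow> x \<notin> V0"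
  using disj0 by blast

lemma join_edge: "S \<in> P \<Longrightarrow> s \<in> S \<Longrightarrow> t \<in> verts (T S) \<Longrightarrow> {s, t} \<in> E"
  unfolding cathedral_def by auto

lemma E_cases:
  assumes "{x, y} \<in> E"
  obtains "{x, y} \<in> edges G0" "x \<in> V0" "y \<in> V0"
    | S where "S \<in> P" "{x, y} \<in> edges (T S)" "x \<in> verts (T S)" "y \<in> verts (T S)"
    | S where "S \<in> P" "x \<in> S" "x \<in> V0" "y \<in> verts (T S)"
    | S where "S \<in> P" "y \<in> S" "y \<in> V0" "x \<in> verts (T S)"
proof -
  consider "{x, y} \<in> edges G0" | S where "S \<in> P" "{x, y} \<in> edges (T S)"
    | u v S where "{x, y} = {u, v}" "S \<in> P" "u \<in> S" "v \<in> verts (T S)"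
    using assms unfolding cathedral_def by auto
  then show thesis
  proof cases
    case 1
    then show thesis using that(1) simple_graph_edgeD[OF G0(1)] by blast
  next
    case 2
    then show thesis using that(2) simple_graph_edgeD[OF T(1)] by blast
  next
    case 3
    then show thesis using that(3,4) canonical_class_subset by (metis doubleton_eq_iff subsetD)
  qed
qed

section \<open>Matchings of the foundation and of the towers\<close>

lemma tower_matchable: "S \<in> P \<Longrightarrow> matchable E (verts (T S))"
  by (rule matchable_mono[OF saturatedD(1)[OF T]]) (auto simp: cathedral_def)

lemma foundation_matchable: "matchable E V0"
  by (rule matchable_mono[OF saturatedD(1)[OF G0(1,2)]]) (auto simp: cathedral_def)

text \<open>A tower that loses \<open>x\<close> has an odd number of vertices left, so one more has
  to be matched into the foundation. The partner of \<open>x\<close> in a perfect matching of the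
  tower is a suitable one.\<close>

lemma tower_partner:
  assumes "S \<in> P" "x \<in> verts (T S)"
  obtains x' where "x' \<in> verts (T S)" "x' \<noteq> x" "matchable E (verts (T S) - {x, x'})"
proof -
  obtain f where f: "matching_fun E (verts (T S)) f"
    using tower_matchable[OF assms(1)] unfolding matchable_def by blast
  have m: "matchable E (verts (T S) - {x, f x})"
    using matching_fun_remove_pair[OF f assms(2)] unfolding matchable_def by blast
  have "f x \<in> verts (T S)" "f x \<noteq> x"
    using f assms(2) unfolding matching_fun_def by auto
  then show thesis using m by (rule that)
qed

lemma towers_matchable:
  assumes "Q \<subseteq> P" shows "matchable E (\<Union>S\<in>Q. verts (T S))"
proof (rule matchable_UN)
  show "disjoint_family_on (\<lambda>S. verts (T S)) Q"
    by (rule disjoint_family_on_mono[OF assms disj])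
  show "finite Q" using assms finite_V(3) by (rule finite_subset)
  show "matchable E (verts (T S))" if "S \<in> Q" for S
    using assms that by (intro tower_matchable) blast
qed

text \<open>Counting in each tower shows that the foundation vertices matched into towers form a set
  to which \<open>saturated_no_even_deficiency\<close> applies.\<close>

lemma no_crossing:
  assumes f: "matching_fun E (verts G) f" and "x \<in> V0"
  shows "f x \<in> V0"
proof -
  have f': "f z \<in> verts G" "f z \<noteq> z" "f (f z) = z" "{z, f z} \<in> E" if "z \<in> verts G" for z
    using f that unfolding matching_fun_def by auto
  have V0V: "z \<in> verts G" if "z \<in> V0" for z using that verts_G by auto
  have TV: "z \<in> verts G" if "S \<in> P" "z \<in> verts (T S)" for z S using that verts_G by auto
  define A where "A = {v \<in> V0. f v \<notin> V0}"
  have "A = {}"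
  proof (rule saturated_no_even_deficiency[OF G0(1,3,2)])
    show "A \<subseteq> V0" unfolding A_def by blast
    \<comment> \<open>The restriction of \<open>f\<close> to the rest of the foundation uses edges
      of \<open>G0\<close> only, because every other edge has an end in a tower.\<close>
    have "f v \<in> V0 - A \<and> f v \<noteq> v \<and> f (f v) = v \<and> {v, f v} \<in> edges G0" if v: "v \<in> V0 - A" for v
    proof -
      have "v \<in> V0" "f v \<in> V0" using v unfolding A_def by auto
      moreover have "{v, f v} \<in> edges G0"
        using f'(4)[OF V0V[OF \<open>v \<in> V0\<close>]]
        by (cases rule: E_cases) (use calculation tower_notin_V0 in blast)+
      ultimately show ?thesis using f'[OF V0V] unfolding A_def by auto
    qed
    then show "matchable (edges G0) (V0 - A)" unfolding matchable_def matching_fun_def by blast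
    fix S assume S: "S \<in> P"
    \<comment> \<open>\<open>B\<close> and the whole tower carry matchings and so have even size.
      Hence evenly many tower vertices are matched to vertices outside the tower.\<close>
    define B where "B = {t \<in> verts (T S). f t \<in> verts (T S)}"
    have fin: "finite (verts (T S))" using T(1)[OF S] unfolding simple_graph_def by blast
    have "matching_fun E B f"
      using f'[OF TV[OF S]] unfolding matching_fun_def B_def by auto
    then have "even (card B)" by (rule matching_fun_even_card) (use fin in \<open>simp add: B_def\<close>)
    moreover have "even (card (verts (T S)))"
      using tower_matchable[OF S] matching_fun_even_card[OF _ fin] unfolding matchable_def by blast
    moreover have "card (verts (T S) - B) = card (verts (T S)) - card B"
      using fin by (intro card_Diff_subset) (auto simp: B_def)
    ultimately have "even (card (verts (T S) - B))" by simp
    \<comment> \<open>An edge leaving the tower over \<open>S\<close> ends in \<open>S\<close>, and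
      an edge from \<open>S\<close> into a tower ends in the one over \<open>S\<close>. So
      \<open>f\<close> pairs off the two sets.\<close>
    moreover have "A \<inter> S = f ` (verts (T S) - B)"
    proof
      show "A \<inter> S \<subseteq> f ` (verts (T S) - B)"
      proof
        fix v assume v: "v \<in> A \<inter> S"
        then have v0: "v \<in> V0" "f v \<notin> V0" unfolding A_def by auto
        have "f v \<in> verts (T S)"
          using f'(4)[OF V0V[OF v0(1)]]
        proof (cases rule: E_cases)
          case (3 S')
          have "v \<in> S" using v by blast
          then have "S' = S" using P_disj[OF 3(1) S 3(2)] by simp
          then show ?thesis using 3(4) by simp
        qed (use v0 tower_notin_V0 in blast)+
        moreover have "f (f v) = v" "v \<notin> verts (T S)"
          using f'(3)[OF V0V[OF v0(1)]] tower_notin_V0[OF S] v0 by auto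
        ultimately show "v \<in> f ` (verts (T S) - B)"
          unfolding B_def by (intro image_eqI[of _ _ "f v"]) auto
      qed
      show "f ` (verts (T S) - B) \<subseteq> A \<inter> S"
      proof
        fix v assume "v \<in> f ` (verts (T S) - B)"
        then obtain t where t: "v = f t" "t \<in> verts (T S)" "f t \<notin> verts (T S)"
          unfolding B_def by blast
        have "f t \<in> S \<and> f t \<in> V0"
          using f'(4)[OF TV[OF S t(2)]]
        proof (cases rule: E_cases)
          case (2 S')
          then have "S' = S" using tower_disj[OF 2(1) S 2(3) t(2)] by simp
          then show ?thesis using 2(4) t(3) by simp
        next
          case (4 S')
          then have "S' = S" using tower_disj[OF 4(1) S 4(4) t(2)] by simp
          then show ?thesis using 4 by simp
        qed (use t(2) tower_notin_V0[OF S] in blast)+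
        then show "v \<in> A \<inter> S"
          using t f'(3)[OF TV[OF S t(2)]] tower_notin_V0[OF S] unfolding A_def by auto
      qed
    qed
    moreover have "inj_on f (verts (T S) - B)"
      by (rule inj_on_inverseI[of _ f]) (use f'(3) TV[OF S] in auto)
    ultimately show "even (card (A \<inter> S))" by (simp add: card_image)
  qed
  then show ?thesis using assms(2) unfolding A_def by blast
qed

section \<open>Saturation of the cathedral\<close>

lemma saturated_G: "saturated G"
proof -
  \<comment> \<open>Towers outside \<open>Q\<close> keep their own perfect matchings, so only the
    foundation and the towers in \<open>Q\<close> need attention.\<close>
  have rest: "matchable E (X \<union> (\<Union>S\<in>P - Q. verts (T S)))"
    if "matchable E X" "X \<subseteq> V0 \<union> (\<Union>S\<in>Q. verts (T S))" "Q \<subseteq> P" for X Q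
  proof (rule matchable_Un[OF that(1) towers_matchable])
    show "X \<inter> (\<Union>S\<in>P - Q. verts (T S)) = {}"
    proof (rule ccontr)
      assume "\<not> ?thesis"
      then obtain z S where "z \<in> X" "S \<in> P" "S \<notin> Q" "z \<in> verts (T S)" by blast
      then show False using that(2,3) tower_notin_V0 tower_disj by blast
    qed
  qed blast
  have mix: False if "S \<in> P" "x \<in> verts (T S)" "x \<in> V0" for S x
    using that tower_notin_V0 by blast
  \<comment> \<open>Both vertices in the foundation: saturation of \<open>G0\<close>
    suffices.\<close>
  have c1: "matchable E (verts G - {x, y})"
    if xy: "x \<in> V0" "y \<in> V0" "x \<noteq> y" "{x, y} \<notin> E" for x y
  proof -
    have "matchable (edges G0) (V0 - {x, y})"
      using xy by (intro saturatedD(2)[OF G0(1,2)]) (auto simp: cathedral_def)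
    then have "matchable E (V0 - {x, y})"
      by (rule matchable_mono) (auto simp: cathedral_def)
    then have "matchable E (V0 - {x, y} \<union> (\<Union>S\<in>P - {}. verts (T S)))"
      by (rule rest) auto
    moreover have "V0 - {x, y} \<union> (\<Union>S\<in>P - {}. verts (T S)) = verts G - {x, y}"
      using xy mix unfolding verts_G by auto
    ultimately show ?thesis by simp
  qed
  \<comment> \<open>Both vertices in one tower: saturation of that tower suffices.\<close>
  have c2: "matchable E (verts G - {x, y})"
    if xy: "S \<in> P" "x \<in> verts (T S)" "y \<in> verts (T S)" "x \<noteq> y" "{x, y} \<notin> E" for x y S
  proof -
    have "matchable (edges (T S)) (verts (T S) - {x, y})"
      using xy by (intro saturatedD(2) T) (auto simp: cathedral_def)
    then have "matchable E (verts (T S) - {x, y})"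
      by (rule matchable_mono) (use xy in \<open>auto simp: cathedral_def\<close>)
    then have "matchable E (V0 \<union> (verts (T S) - {x, y}))"
      using foundation_matchable disj0[OF xy(1)] by (intro matchable_Un) auto
    then have "matchable E (V0 \<union> (verts (T S) - {x, y}) \<union> (\<Union>S\<in>P - {S}. verts (T S)))"
      by (rule rest) (use xy in auto)
    moreover have "V0 \<union> (verts (T S) - {x, y}) \<union> (\<Union>S\<in>P - {S}. verts (T S)) = verts G - {x, y}"
      using xy mix tower_disj unfolding verts_G by blast
    ultimately show ?thesis by simp
  qed
  \<comment> \<open>One vertex in the foundation and one in a tower: the tower sends the former
    partner \<open>y'\<close> of \<open>y\<close> to some \<open>s\<close> in its class, and the
    foundation is matched without \<open>x\<close> and \<open>s\<close>.\<close>
  have c3: "matchable E (verts G - {x, y})"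
    if xy: "x \<in> V0" "S \<in> P" "y \<in> verts (T S)" "{x, y} \<notin> E" for x y S
  proof -
    \<comment> \<open>Every vertex of \<open>S\<close> is joined to \<open>y\<close>.\<close>
    have "x \<notin> S" using join_edge xy by blast
    obtain s where s: "s \<in> S" using P_nonempty xy(2) by blast
    have s0: "s \<in> V0" using canonical_class_subset xy(2) s by blast
    obtain y' where y': "y' \<in> verts (T S)" "y' \<noteq> y" "matchable E (verts (T S) - {y, y'})"
      using tower_partner xy by blast
    have "matchable E (V0 - {x, s} \<union> (verts (T S) - {y, y'}))"
      using P_apart[OF xy(2) s xy(1) \<open>x \<notin> S\<close>] y'(3) disj0[OF xy(2)] by (intro matchable_Un) auto
    then have "matchable E (V0 - {x, s} \<union> (verts (T S) - {y, y'}) \<union> {s, y'})"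
      using join_edge[OF xy(2) s y'(1)] s0 y'(1) mix xy(2) by (intro matchable_insert_edge) auto
    then have "matchable E (V0 - {x, s} \<union> (verts (T S) - {y, y'}) \<union> {s, y'} \<union>
        (\<Union>S\<in>P - {S}. verts (T S)))"
      by (rule rest) (use xy y' s0 in auto)
    moreover have "V0 - {x, s} \<union> (verts (T S) - {y, y'}) \<union> {s, y'} \<union> (\<Union>S\<in>P - {S}. verts (T S))
        = verts G - {x, y}"
      using xy y' s s0 \<open>x \<notin> S\<close> mix tower_disj unfolding verts_G by blast
    ultimately show ?thesis by simp
  qed
  \<comment> \<open>Vertices in different towers: each tower sends one vertex to its own class. The
    foundation vertices \<open>s\<close> and \<open>r\<close> used for this lie in different
    classes, so the rest of the foundation is matchable.\<close>
  have c4: "matchable E (verts G - {x, y})"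
    if xy: "S \<in> P" "x \<in> verts (T S)" "R \<in> P" "y \<in> verts (T R)" "S \<noteq> R" for x y S R
  proof -
    obtain s r where s: "s \<in> S" and r: "r \<in> R" using P_nonempty xy by blast
    have sr: "s \<in> V0" "r \<in> V0" "s \<notin> R" "r \<notin> S" "s \<noteq> r"
      using canonical_class_subset P_disj xy s r by blast+
    obtain x' where x': "x' \<in> verts (T S)" "x' \<noteq> x" "matchable E (verts (T S) - {x, x'})"
      using tower_partner xy by blast
    obtain y' where y': "y' \<in> verts (T R)" "y' \<noteq> y" "matchable E (verts (T R) - {y, y'})"
      using tower_partner xy by blast
    let ?A = "verts (T S) - {x, x'}" and ?B = "verts (T R) - {y, y'}"
    have SR: "verts (T S) \<inter> verts (T R) = {}" using tower_disj xy by blast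
    have out: "x' \<notin> V0" "y' \<notin> V0" "x' \<notin> verts (T R)" "y' \<notin> verts (T S)"
      "s \<notin> verts (T S)" "s \<notin> verts (T R)" "r \<notin> verts (T S)" "r \<notin> verts (T R)"
      using SR x' y' xy sr mix by blast+
    have "matchable E (V0 - {s, r} \<union> ?A)"
      using disj0[OF xy(1)] by (intro matchable_Un[OF P_apart[OF xy(3) r sr(1,3)] x'(3)]) blast
    then have "matchable E (V0 - {s, r} \<union> ?A \<union> ?B)"
      using disj0[OF xy(3)] SR by (intro matchable_Un[OF _ y'(3)]) blast+
    then have "matchable E (V0 - {s, r} \<union> ?A \<union> ?B \<union> {s, x'})"
      by (rule matchable_insert_edge[OF _ join_edge[OF xy(1) s x'(1)]]) (use sr out in auto)
    then have "matchable E (V0 - {s, r} \<union> ?A \<union> ?B \<union> {s, x'} \<union> {r, y'})"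
      by (rule matchable_insert_edge[OF _ join_edge[OF xy(3) r y'(1)]]) (use sr out x' y' in auto)
    then have "matchable E (V0 - {s, r} \<union> ?A \<union> ?B \<union> {s, x'} \<union> {r, y'} \<union>
        (\<Union>S\<in>P - {S, R}. verts (T S)))"
      by (rule rest) (use xy x' y' sr in auto)
    moreover have "V0 - {s, r} \<union> ?A \<union> ?B \<union> {s, x'} \<union> {r, y'} \<union> (\<Union>S\<in>P - {S, R}. verts (T S))
        = verts G - {x, y}" (is "?L = _")
    proof -
      have "x \<notin> V0" "y \<notin> V0" "x \<notin> verts (T R)" "y \<notin> verts (T S)"
        using SR xy mix by blast+
      moreover have "x \<notin> verts (T S')" "y \<notin> verts (T S')" if "S' \<in> P - {S, R}" for S'
        using that tower_disj xy by blast+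
      moreover have "verts G = V0 \<union> verts (T S) \<union> verts (T R) \<union> (\<Union>S\<in>P - {S, R}. verts (T S))"
        using xy unfolding verts_G by blast
      ultimately show ?thesis using x' y' sr out by auto
    qed
    ultimately show ?thesis by simp
  qed
  have "matchable E (V0 \<union> (\<Union>S\<in>P - {}. verts (T S)))"
    using foundation_matchable by (rule rest) auto
  then have "matchable E (verts G)" unfolding verts_G by simp
  moreover have "matchable E (verts G - {x, y})"
    if xy: "x \<in> verts G" "y \<in> verts G" "x \<noteq> y" "{x, y} \<notin> E" for x y
  proof (cases "x \<in> V0")
    case x: True
    show ?thesis
    proof (cases "y \<in> V0")
      case True
      then show ?thesis using c1 x xy by blast
    next
      case False
      then show ?thesis using c3 x xy unfolding verts_G by blast
    qed
  next
    case False
    then obtain S where S: "S \<in> P" "x \<in> verts (T S)" using xy(1) unfolding verts_G by blast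
    show ?thesis
    proof (cases "y \<in> V0")
      case True
      then show ?thesis using c3[of y S x] S xy by (simp add: insert_commute)
    next
      case False
      then obtain R where "R \<in> P" "y \<in> verts (T R)" using xy(2) unfolding verts_G by blast
      then show ?thesis using c2 c4 S xy by (cases "S = R") blast+
    qed
  qed
  ultimately show ?thesis unfolding saturated_iff[OF simple] by blast
qed

section \<open>The foundation as the minimum factor-connected component\<close>

lemma foundation_component: "induced G V0 \<in> factor_components G"
proof -
  have V: "\<Union>(allowed_edges G) = verts G"
    using simple saturated_G Union_allowed_edges unfolding saturated_def by blast
  define R where "R = {(x, y). {x, y} \<in> allowed_edges G}"
  obtain u where u: "u \<in> V0" using elementary_connected(1)[OF G0(1,3)] by blast
  \<comment> \<open>Walks along allowed edges never leave the foundation, since an edge of a perfect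
    matching at a foundation vertex stays inside by \<open>no_crossing\<close>.\<close>
  have "v \<in> V0" if "(u, v) \<in> R\<^sup>*" for v
    using that
  proof (induction rule: rtrancl_induct)
    case (step y z)
    then obtain M where M: "perfect_matching G M" "{y, z} \<in> M"
      unfolding R_def allowed_edges_def by auto
    obtain f where f: "matching_fun M (verts G) f"
      using simple M(1) by (rule perfect_matching_imp_matching_fun)
    have y: "y \<in> verts G" using step.IH unfolding verts_G by blast
    then have "{y, f y} = {y, z}"
      using f perfect_matchingD(3)[OF M(1) y _ M(2), of "{y, f y}"]
      unfolding matching_fun_def by blast
    then have "f y = z" by (auto simp: doubleton_eq_iff)
    moreover have "matching_fun E (verts G) f"
      using f perfect_matchingD(1)[OF M(1)] by (rule matching_fun_mono)
    ultimately show ?case using no_crossing step.IH by blast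
  qed (use u in simp)
  \<comment> \<open>Conversely, edges allowed in \<open>G0\<close> remain allowed in the cathedral,
    because perfect matchings of all towers can be added. Connectedness of the elementary graph
    \<open>G0\<close> then carries over.\<close>
  moreover have "(u, v) \<in> R\<^sup>*" if "v \<in> V0" for v
  proof -
    have "{(x, y). {x, y} \<in> allowed_edges G0} \<subseteq> R"
    proof clarify
      fix x y assume "{x, y} \<in> allowed_edges G0"
      then have xy: "{x, y} \<in> edges G0" "matchable (edges G0) (V0 - {x, y})"
        using allowed_edges_iff[OF G0(1)] by auto
      have "matchable E (V0 - {x, y})"
        using xy(2) by (rule matchable_mono) (auto simp: cathedral_def)
      then have "matchable E (V0 - {x, y} \<union> (\<Union>S\<in>P. verts (T S)))"
        using towers_matchable[of P] disj0 by (intro matchable_Un) auto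
      moreover have "V0 - {x, y} \<union> (\<Union>S\<in>P. verts (T S)) = verts G - {x, y}"
        using simple_graph_edgeD[OF G0(1) xy(1)] disj0 unfolding verts_G by blast
      ultimately show "(x, y) \<in> R"
        using xy(1) allowed_edges_iff[OF simple] unfolding R_def by (simp add: cathedral_def)
    qed
    then show ?thesis
      using elementary_connected(2)[OF G0(1,3) u that] rtrancl_mono by blast
  qed
  ultimately have "{v. (u, v) \<in> R\<^sup>*} = V0" by blast
  then have "induced \<lparr>verts = verts G, edges = allowed_edges G\<rparr> V0 \<in> elementary_components G"
    unfolding elementary_components_def connected_components_def V R_def
    by (intro image_eqI[of _ _ u]) (use u verts_G in simp_all)
  moreover have "verts (induced \<lparr>verts = verts G, edges = allowed_edges G\<rparr> V0) = V0"
    unfolding induced_def verts_G by auto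
  ultimately show ?thesis unfolding factor_components_def by (metis imageI)
qed

text \<open>In the contracted graph \<open>None\<close> is adjacent to every tower vertex. Deleting
  \<open>None\<close> leaves the perfectly matchable towers; deleting a tower vertex frees its
  partner, which is then matched to \<open>None\<close>.\<close>

lemma factor_critical_contract: "factor_critical (contract G V0)"
proof -
  define c where "c v = (if v \<in> V0 then None else Some v)" for v
  define W where "W = (\<Union>S\<in>P. verts (T S))"
  let ?C = "contract G V0"
  have W0: "W \<inter> V0 = {}" unfolding W_def using disj0 by blast
  have cW: "c w = Some w" if "w \<in> W" for w using that W0 unfolding c_def by auto
  have edgesC: "edges ?C = {c ` e |e. e \<in> E \<and> card (c ` e) = 2}"
    unfolding contract_def c_def by simp
  have vertsC: "verts ?C = insert None (Some ` W)"
  proof -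
    have "verts ?C = c ` (V0 \<union> W)"
      unfolding contract_def c_def W_def verts_G[symmetric] by simp
    also have "\<dots> = c ` V0 \<union> Some ` W" unfolding image_Un using cW by simp
    also have "c ` V0 = {None}"
      using elementary_connected(1)[OF G0(1,3)] unfolding c_def by auto
    finally show ?thesis by simp
  qed
  have edge_Some: "{Some a, Some b} \<in> edges ?C" if "{a, b} \<in> E" "a \<in> W" "b \<in> W" "a \<noteq> b" for a b
    unfolding edgesC using that cW by (auto intro!: exI[of _ "{a, b}"])
  \<comment> \<open>Classes are nonempty, so each tower vertex has a neighbour in the
    foundation.\<close>
  have edge_None: "{None, Some t} \<in> edges ?C" if t: "t \<in> W" for t
  proof -
    obtain S s where S: "S \<in> P" "t \<in> verts (T S)" "s \<in> S"
      using t P_nonempty unfolding W_def by blast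
    then have "c s = None" using canonical_class_subset unfolding c_def by auto
    then show ?thesis
      unfolding edgesC using join_edge[OF S(1,3,2)] cW[OF t]
      by (auto intro!: exI[of _ "{s, t}"])
  qed
  have lift: "matchable (edges ?C) (Some ` X)" if "matchable E X" "X \<subseteq> W" for X
  proof -
    obtain f where "matching_fun E X f" using \<open>matchable E X\<close> unfolding matchable_def by blast
    then have "matching_fun (edges ?C) (Some ` X) (map_option f)"
      using that(2) edge_Some unfolding matching_fun_def by (auto simp: subset_iff)
    then show ?thesis unfolding matchable_def by blast
  qed
  have W: "matchable E W" using towers_matchable[of P] unfolding W_def by simp
  have "matchable (edges ?C) (verts ?C - {z})" if "z \<in> verts ?C" for z
  proof (cases z)
    case None
    then have "verts ?C - {z} = Some ` W" unfolding vertsC by auto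
    then show ?thesis using lift[OF W] by simp
  next
    case (Some t)
    then have t: "t \<in> W" using that unfolding vertsC by auto
    obtain f where f: "matching_fun E W f" using W unfolding matchable_def by blast
    have "matchable E (W - {t, f t})"
      using matching_fun_remove_pair[OF f t] unfolding matchable_def by blast
    then have "matchable (edges ?C) (Some ` (W - {t, f t}))" by (rule lift) blast
    moreover have ft: "f t \<in> W" "f t \<noteq> t" using f t unfolding matching_fun_def by auto
    ultimately have "matchable (edges ?C) (Some ` (W - {t, f t}) \<union> {None, Some (f t)})"
      using edge_None by (intro matchable_insert_edge) auto
    moreover have "Some ` (W - {t, f t}) \<union> {None, Some (f t)} = verts ?C - {z}"
      using ft t Some unfolding vertsC by auto
    ultimately show ?thesis by simp
  qed
  then show ?thesis
    using factorizable_delete_iff_matchable[OF simple_graph_contract[OF simple]] vertsC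
    unfolding factor_critical_def by simp
qed

text \<open>The whole vertex set is separating and contains every component, so the single
  contraction of \<open>V0\<close> in the whole graph works for all \<open>H\<close>.\<close>

lemma foundation_le:
  assumes "H \<in> factor_components G"
  shows "component_le G (induced G V0) H"
proof -
  have "induced G (verts G) = G"
    using simple unfolding induced_def simple_graph_def by (auto intro!: graph.equality)
  moreover have "verts (induced G V0) = V0"
    unfolding induced_def verts_G by auto
  moreover have "separating G (verts G)"
    using factor_component_verts unfolding separating_def by blast
  moreover have "V0 \<union> verts H \<subseteq> verts G"
    using factor_component_verts[OF assms] verts_G by blast
  ultimately show ?thesis
    using assms foundation_component factor_critical_contract
    unfolding component_le_def by (intro conjI exI[of _ "verts G"]) simp_all
qed

end

theorem theorem8:
  fixes G0 G :: "'a graph" and T :: "'a set \<Rightarrow> 'a graph"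
  assumes "simple_graph G0" and "saturated G0" and "elementary G0"
    and "\<forall>S\<in>canonical_partition G0. simple_graph (T S) \<and> saturated (T S)"
    and "\<forall>S\<in>canonical_partition G0. verts G0 \<inter> verts (T S) = {}"
    and "disjoint_family_on (\<lambda>S. verts (T S)) (canonical_partition G0)"
    and "G = cathedral G0 T"
  shows "saturated G \<and>
    induced G (verts G0) \<in> factor_components G \<and>
    (\<forall>H\<in>factor_components G. component_le G (induced G (verts G0)) H)"
proof -
  interpret cathedral_graph G0 T
    using assms(1-6) by unfold_locales auto
  show ?thesis
    unfolding assms(7) using saturated_G foundation_component foundation_le by blast
qed

end
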